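(* Let $k\ge 1$ and let $G$ be a $k$-tree with $n\ge k+1$ vertices such that all cliques of $G$ with $k+1$ vertices have a common vertex. Then $G$ is chromatic dominated, i.e. $\chi(G)=\chi_{dom}(G)$.
   Context: A set $S$ of vertices of a graph $G$ is dominated by a vertex $v$ if every vertex of $S$ is adjacent to $v$. A dominated coloring of $G$ is a proper vertex coloring in which each (nonempty) color class is dominated by some vertex of $G$; $\chi_{dom}(G)$ is the minimum number of colors in a dominated coloring of $G$. $\chi(G)$ is the chromatic number, and $G$ is chromatic dominated if $\chi(G)=\chi_{dom}(G)$. A $k$-tree is a graph that can be reduced to the complete graph on $k$ vertices by a sequence of removals of a degree-$k$ vertex whose neighbors are pairwise adjacent. The $k$-tree with $k+1$ vertices (the complete graph on $k+1$ vertices) is called the base clique. *)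

theory Defs
  imports "Graph_Theory.Graph_Theory" "HOL-Library.Extended_Nat"
begin

text \<open>
  A finite simple graph is a pre-digraph satisfying the locale \<^locale>\<open>graph\<close>, so each edge is
  represented by a pair of opposite arcs. Adjacency is \<open>u \<rightarrow>\<^bsub>G\<^esub> v\<close> (which the library calls
  \<^abbrev>\<open>dominates\<close>), and the degree of a vertex is its \<^const>\<open>out_degree\<close>.
\<close>

definition clique :: "('a, 'b) pre_digraph \<Rightarrow> 'a set \<Rightarrow> bool" where
  "clique G K \<longleftrightarrow> K \<subseteq> verts G \<and> (\<forall>u\<in>K. \<forall>v\<in>K. u \<noteq> v \<longrightarrow> u \<rightarrow>\<^bsub>G\<^esub> v)"

definition neighbors :: "('a, 'b) pre_digraph \<Rightarrow> 'a \<Rightarrow> 'a set" where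
  "neighbors G v = {u \<in> verts G. v \<rightarrow>\<^bsub>G\<^esub> u}"

inductive k_tree :: "nat \<Rightarrow> ('a, 'b) pre_digraph \<Rightarrow> bool" for k :: nat where
  complete: "complete_digraph k G \<Longrightarrow> k_tree k G"
| remove: "\<lbrakk>graph G; v \<in> verts G; out_degree G v = k; clique G (neighbors G v);
            k_tree k (pre_digraph.del_vert G v)\<rbrakk> \<Longrightarrow> k_tree k G"

lemma k_tree_graph: "k_tree k G \<Longrightarrow> graph G"
  by (cases rule: k_tree.cases) (auto simp: complete_digraph_def)

definition proper_coloring :: "('a, 'b) pre_digraph \<Rightarrow> ('a \<Rightarrow> nat) \<Rightarrow> bool" where
  "proper_coloring G c \<longleftrightarrow> (\<forall>u\<in>verts G. \<forall>v\<in>verts G. u \<rightarrow>\<^bsub>G\<^esub> v \<longrightarrow> c u \<noteq> c v)"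

definition color_class :: "('a, 'b) pre_digraph \<Rightarrow> ('a \<Rightarrow> nat) \<Rightarrow> nat \<Rightarrow> 'a set" where
  "color_class G c i = {u \<in> verts G. c u = i}"

definition dominated_by :: "('a, 'b) pre_digraph \<Rightarrow> 'a set \<Rightarrow> 'a \<Rightarrow> bool" where
  "dominated_by G S v \<longleftrightarrow> (\<forall>u\<in>S. u \<rightarrow>\<^bsub>G\<^esub> v)"

text \<open>Only the colors that occur on \<^term>\<open>verts G\<close> have a nonempty class.\<close>

definition dominated_coloring :: "('a, 'b) pre_digraph \<Rightarrow> ('a \<Rightarrow> nat) \<Rightarrow> bool" where
  "dominated_coloring G c \<longleftrightarrow> proper_coloring G c \<and>
     (\<forall>i\<in>c ` verts G. \<exists>v\<in>verts G. dominated_by G (color_class G c i) v)"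

text \<open>
  The two numbers are meant for finite graphs. The infimum over \<^typ>\<open>enat\<close> is attained whenever
  the set of colorings is nonempty, hence is then a minimum; a graph with an isolated vertex has no
  dominated coloring, and its dominated chromatic number is \<open>\<infinity>\<close>.
\<close>

definition chromatic_number :: "('a, 'b) pre_digraph \<Rightarrow> enat" where
  "chromatic_number G = (INF c\<in>{c. proper_coloring G c}. enat (card (c ` verts G)))"

definition dominated_chromatic_number :: "('a, 'b) pre_digraph \<Rightarrow> enat" where
  "dominated_chromatic_number G = (INF c\<in>{c. dominated_coloring G c}. enat (card (c ` verts G)))"

definition chromatic_dominated :: "('a, 'b) pre_digraph \<Rightarrow> bool" where
  "chromatic_dominated G \<longleftrightarrow> chromatic_number G = dominated_chromatic_number G"

end

theory Submission
  imports Defs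
begin

text \<open>
  In a \<open>k\<close>-tree with more than \<open>k\<close> vertices every vertex lies in some clique of size \<open>k + 1\<close>
  (\<open>k_tree_vertex_in_clique\<close>): when a vertex is attached to a \<open>k\<close>-clique, it forms such a clique
  together with its neighbors. So a vertex \<open>x\<close> common to all these cliques is adjacent to every
  other vertex of the graph.

  In any proper coloring, then, \<open>x\<close> has a color of its own. It dominates every other color class,
  and its own class \<open>{x}\<close> is dominated by any of its neighbors. Hence every proper coloring is
  already a dominated one (\<open>proper_coloring_dominated_if_universal_vertex\<close>), and the two chromatic
  numbers are minima over the same set of colorings.
\<close>

lemma (in digraph) card_neighbors_eq_out_degree: "card (neighbors G v) = out_degree G v"
proof -
  have "neighbors G v = head G ` out_arcs G v"
    unfolding neighbors_def out_arcs_def arcs_ends_conv by (auto simp: image_iff)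
  moreover have "inj_on (head G) (out_arcs G v)"
  proof (rule inj_onI)
    fix a b assume "a \<in> out_arcs G v" "b \<in> out_arcs G v" "head G a = head G b"
    then show "a = b"
      by (intro no_multi_arcs) (simp_all add: out_arcs_def arc_to_ends_def)
  qed
  ultimately show ?thesis
    by (simp add: out_degree_def card_image)
qed

lemma clique_mono: "subgraph H G \<Longrightarrow> clique H K \<Longrightarrow> clique G K"
  unfolding clique_def by (blast dest: arcs_ends_mono subgraph_imp_subverts)

lemma (in graph) clique_insert_neighbors:
  assumes "v \<in> verts G" "clique G (neighbors G v)"
  shows "clique G (insert v (neighbors G v))"
proof -
  have out: "v \<rightarrow>\<^bsub>G\<^esub> u" if "u \<in> neighbors G v" for u
    using that by (simp add: neighbors_def)
  have "u \<rightarrow>\<^bsub>G\<^esub> v" if "u \<in> neighbors G v" for u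
    by (rule arcs_ends_symmetric[OF sym_arcs out[OF that]])
  with out show ?thesis
    using assms unfolding clique_def by blast
qed

text \<open>
  Induction along the removals. The subtle case is the one where \<open>v\<close> is removed and only \<open>k\<close>
  vertices remain: the induction hypothesis is void there, but then the remaining vertices are
  exactly the \<open>k\<close> neighbors of \<open>v\<close>, so that the clique around \<open>v\<close> covers them.
\<close>

lemma k_tree_vertex_in_clique:
  assumes "k_tree k G" "k + 1 \<le> card (verts G)" "u \<in> verts G"
  shows "\<exists>K. clique G K \<and> card K = k + 1 \<and> u \<in> K"
  using assms
proof (induction arbitrary: u rule: k_tree.induct)
  case (complete G)
  then show ?case by (simp add: complete_digraph_def)
next
  case (remove G v)
  interpret graph G by fact
  let ?N = "neighbors G v"
  have verts_del: "verts (del_vert v) = verts G - {v}"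
    by (simp add: verts_del_vert)
  have N_sub: "?N \<subseteq> verts (del_vert v)"
    unfolding verts_del neighbors_def by (auto dest: adj_not_same)
  have card_N: "card ?N = k"
    using remove.hyps by (simp add: card_neighbors_eq_out_degree)
  have fin_del: "finite (verts (del_vert v))"
    by (simp add: verts_del)
  have "v \<notin> ?N"
    using N_sub by (auto simp: verts_del)
  then have "card (insert v ?N) = k + 1"
    using card_N finite_subset[OF N_sub fin_del] by simp
  then have new_clique: "clique G (insert v ?N) \<and> card (insert v ?N) = k + 1"
    using clique_insert_neighbors[OF remove.hyps(2,4)] by simp
  show ?case
  proof (cases "u \<in> insert v ?N")
    case True
    then show ?thesis using new_clique by blast
  next
    case False
    then have u: "u \<in> verts (del_vert v)"
      using remove.prems by (simp add: verts_del)
    with False N_sub have "?N \<subset> verts (del_vert v)"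
      by blast
    then have "card ?N < card (verts (del_vert v))"
      by (rule psubset_card_mono[OF fin_del])
    with card_N have "k + 1 \<le> card (verts (del_vert v))"
      by simp
    from remove.IH[OF this u] obtain K where "clique (del_vert v) K" "card K = k + 1" "u \<in> K"
      by auto
    then show ?thesis
      using clique_mono[OF subgraph_del_vert] by blast
  qed
qed

lemma (in graph) proper_coloring_dominated_if_universal_vertex:
  assumes x: "x \<in> verts G" "\<And>u. u \<in> verts G \<Longrightarrow> u \<noteq> x \<Longrightarrow> u \<rightarrow>\<^bsub>G\<^esub> x"
    and y: "y \<in> verts G" "y \<noteq> x"
    and proper: "proper_coloring G c"
  shows "dominated_coloring G c"
  unfolding dominated_coloring_def
proof (intro conjI ballI)
  fix i assume "i \<in> c ` verts G"
  show "\<exists>v\<in>verts G. dominated_by G (color_class G c i) v"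
  proof (cases "i = c x")
    case True
    then have "color_class G c i \<subseteq> {x}"
      using proper x unfolding color_class_def proper_coloring_def by blast
    moreover have "x \<rightarrow>\<^bsub>G\<^esub> y"
      by (rule arcs_ends_symmetric[OF sym_arcs x(2)[OF y]])
    ultimately show ?thesis
      using y unfolding dominated_by_def by blast
  next
    case False
    then show ?thesis
      using x unfolding dominated_by_def color_class_def by blast
  qed
qed (fact proper)

theorem theorem2p9:
  fixes k n :: nat and G :: "('a, 'b) pre_digraph"
  assumes "k \<ge> 1"
    and "k_tree k G"
    and "card (verts G) = n"
    and "n \<ge> k + 1"
    and "\<exists>x\<in>verts G. \<forall>K. clique G K \<and> card K = k + 1 \<longrightarrow> x \<in> K"
  shows "chromatic_dominated G"
proof -
  interpret graph G by (rule k_tree_graph) fact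
  obtain x where x: "x \<in> verts G" "\<And>K. clique G K \<Longrightarrow> card K = k + 1 \<Longrightarrow> x \<in> K"
    using assms(5) by blast
  have universal: "u \<rightarrow>\<^bsub>G\<^esub> x" if u: "u \<in> verts G" "u \<noteq> x" for u
  proof -
    obtain K where "clique G K" "card K = k + 1" "u \<in> K"
      using k_tree_vertex_in_clique[of k G u] assms u by auto
    then show ?thesis
      using x(2) u(2) unfolding clique_def by blast
  qed
  have "\<not> verts G \<subseteq> {x}"
    using card_mono[of "{x}" "verts G"] assms(1,3,4) by auto
  then obtain y where y: "y \<in> verts G" "y \<noteq> x"
    by blast
  have "{c. proper_coloring G c} = {c. dominated_coloring G c}"
    using proper_coloring_dominated_if_universal_vertex[OF x(1) universal y]
    by (auto simp: dominated_coloring_def)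
  then show ?thesis
    by (simp add: chromatic_dominated_def chromatic_number_def dominated_chromatic_number_def)
qed

end
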